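(* Let $T$ be an infinite rooted tree, let $0<q<p<\infty$, let $\psi:T\to\mathbb{C}$, and let $M_\psi:\mathbb{T}_p\to\mathbb{T}_q$ be a bounded multiplication operator. Then $M_\psi$ is a compact operator if and only if $$M_{\frac{pq}{p-q}}(n,\psi)\to0\quad\text{as } n\to\infty,\quad\text{i.e., }\psi\in\mathbb{T}_{\frac{pq}{p-q},0}.$$
   Context: Let $T$ be an infinite rooted tree with root $o$; $T$ also denotes its vertex set. For a vertex $v$, $|v|$ is the number of edges in the unique path from $o$ to $v$. For $n\in\mathbb{N}_0=\{0,1,2,\dots\}$, $D_n=\{v\in T:|v|=n\}$, and $c_n$ is the number of elements of $D_n$, assumed finite for each $n$ (so $1\le c_n<\infty$). For $f:T\to\mathbb{C}$ and $0<p<\infty$ put $M_p(n,f)=\left(\frac1{c_n}\sum_{|v|=n}|f(v)|^p\right)^{1/p}$, $\|f\|_p=\sup_{n\in\mathbb{N}_0}M_p(n,f)$, $\mathbb{T}_p=\{f:T\to\mathbb{C}:\|f\|_p<\infty\}$ and $\mathbb{T}_{p,0}=\{f\in\mathbb{T}_p:\lim_{n\to\infty}M_p(n,f)=0\}$. For $\psi:T\to\mathbb{C}$, $M_\psi f=\psi f$ (pointwise product). $M_\psi:X\to Y$ is bounded if it maps $X$ into $Y$ and $\sup\{\|\psi f\|_Y/\|f\|_X: f\in X, f\neq0\}<\infty$. It is compact if for every $\|\cdot\|_X$-bounded sequence $\{f_n\}$ in $X$ the sequence $\{\psi f_n\}$ has a subsequence converging in $Y$ with respect to $\|\cdot\|_Y$.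 *)

theory Defs
  imports Complex_Main "HOL-Library.Extended_Nonnegative_Real" "Graph_Theory.Arc_Walk"
begin

text \<open>
  As usual in \<^theory>\<open>Graph_Theory.Digraph\<close>, an undirected simple graph is a symmetric digraph
  without loops and parallel arcs. The library's own predicate for trees excludes all directed
  cycles, hence also the closed walk formed by an arc and its reverse, so it does not apply to
  symmetric digraphs; a tree is therefore defined by the uniqueness of (simple) paths.
\<close>

locale rooted_tree = sym_digraph G + loopfree_digraph G + nomulti_digraph G
  for G :: "('a, 'b) pre_digraph" (structure) +
  fixes \<rho> :: 'a
  assumes root_in_verts: "\<rho> \<in> verts G"
    and unique_path: "\<lbrakk>u \<in> verts G; v \<in> verts G\<rbrakk> \<Longrightarrow> \<exists>!p. apath u p v"

definition level :: "('a, 'b) pre_digraph \<Rightarrow> 'a \<Rightarrow> 'a \<Rightarrow> nat" where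
  "level G \<rho> v = length (THE p. pre_digraph.apath G \<rho> p v)"

definition level_set :: "('a, 'b) pre_digraph \<Rightarrow> 'a \<Rightarrow> nat \<Rightarrow> 'a set" where
  "level_set G \<rho> n = {v \<in> verts G. level G \<rho> v = n}"

locale infinite_rooted_tree = rooted_tree G \<rho>
  for G :: "('a, 'b) pre_digraph" (structure) and \<rho> :: 'a +
  assumes infinite_verts: "infinite (verts G)"
    and finite_level_set: "finite (level_set G \<rho> n)"

text \<open>
  Functions on the tree are functions on the type of vertices; everything below depends only on
  their values on the vertex set of the graph.
\<close>

definition level_mean ::
  "('a, 'b) pre_digraph \<Rightarrow> 'a \<Rightarrow> real \<Rightarrow> nat \<Rightarrow> ('a \<Rightarrow> complex) \<Rightarrow> real" where
  "level_mean G \<rho> p n f =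
     (1 / real (card (level_set G \<rho> n)) *
       (\<Sum>v\<in>level_set G \<rho> n. cmod (f v) powr p)) powr (1 / p)"

definition tree_norm ::
  "('a, 'b) pre_digraph \<Rightarrow> 'a \<Rightarrow> real \<Rightarrow> ('a \<Rightarrow> complex) \<Rightarrow> ennreal" where
  "tree_norm G \<rho> p f = (SUP n. ennreal (level_mean G \<rho> p n f))"

definition tree_space ::
  "('a, 'b) pre_digraph \<Rightarrow> 'a \<Rightarrow> real \<Rightarrow> ('a \<Rightarrow> complex) set" where
  "tree_space G \<rho> p = {f. tree_norm G \<rho> p f < \<infinity>}"

definition tree_space0 ::
  "('a, 'b) pre_digraph \<Rightarrow> 'a \<Rightarrow> real \<Rightarrow> ('a \<Rightarrow> complex) set" where
  "tree_space0 G \<rho> p =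
     {f \<in> tree_space G \<rho> p. (\<lambda>n. level_mean G \<rho> p n f) \<longlonglongrightarrow> 0}"

definition mult_op :: "('a \<Rightarrow> complex) \<Rightarrow> ('a \<Rightarrow> complex) \<Rightarrow> 'a \<Rightarrow> complex" where
  "mult_op \<psi> f = (\<lambda>v. \<psi> v * f v)"

definition bounded_mult_op ::
  "('a, 'b) pre_digraph \<Rightarrow> 'a \<Rightarrow> real \<Rightarrow> real \<Rightarrow> ('a \<Rightarrow> complex) \<Rightarrow> bool" where
  "bounded_mult_op G \<rho> p q \<psi> \<longleftrightarrow>
     (\<forall>f \<in> tree_space G \<rho> p. mult_op \<psi> f \<in> tree_space G \<rho> q) \<and>
     (SUP f \<in> {f \<in> tree_space G \<rho> p. \<exists>v \<in> verts G. f v \<noteq> 0}.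
        tree_norm G \<rho> q (mult_op \<psi> f) / tree_norm G \<rho> p f) < \<infinity>"

definition compact_mult_op ::
  "('a, 'b) pre_digraph \<Rightarrow> 'a \<Rightarrow> real \<Rightarrow> real \<Rightarrow> ('a \<Rightarrow> complex) \<Rightarrow> bool" where
  "compact_mult_op G \<rho> p q \<psi> \<longleftrightarrow>
     (\<forall>f :: nat \<Rightarrow> 'a \<Rightarrow> complex.
        (\<forall>k. f k \<in> tree_space G \<rho> p) \<and> (SUP k. tree_norm G \<rho> p (f k)) < \<infinity> \<longrightarrow>
        (\<exists>(s :: nat \<Rightarrow> nat) g. strict_mono s \<and> g \<in> tree_space G \<rho> q \<and>
           (\<lambda>k. tree_norm G \<rho> q (\<lambda>v. mult_op \<psi> (f (s k)) v - g v)) \<longlonglongrightarrow> 0))"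

end

theory Submission
  imports Defs "HOL-Complex_Analysis.Great_Picard"
begin

text \<open>
  Put \<open>r = pq/(p - q)\<close>, so \<open>1/q = 1/r + 1/p\<close>, and Hoelder's inequality on each level bounds the
  \<open>q\<close>-mean of \<open>\<psi> f\<close> by the \<open>r\<close>-mean of \<open>\<psi>\<close> times the \<open>p\<close>-mean of \<open>f\<close>. If the \<open>r\<close>-means of \<open>\<psi>\<close>
  tend to 0, a bounded sequence has a pointwise convergent subsequence; the deep levels of its
  image are uniformly small, and on the finitely many remaining vertices pointwise convergence
  suffices. Conversely, if the \<open>r\<close>-means stay above \<open>e\<close> along a sequence of levels, the functions
  that attain equality in Hoelder's inequality on these levels are bounded, and their images have
  norm at least \<open>e\<close> but can only converge to 0.
\<close>

section \<open>Elementary inequalities for finite sums and real powers\<close>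

text \<open>Divide \<open>a\<close> and \<open>b\<close> by their norms and sum Young's inequality
  over the terms: the right-hand sides add up to \<open>1 / s + 1 / t\<close>. When one of the norms
  vanishes, every product is zero.\<close>

lemma Holder_inequality_sum:
  fixes a b :: "'i \<Rightarrow> real"
  assumes "finite A" "s > 1" "t > 1" "1 / s + 1 / t = 1"
    and a: "\<And>i. i \<in> A \<Longrightarrow> 0 \<le> a i" and b: "\<And>i. i \<in> A \<Longrightarrow> 0 \<le> b i"
  shows "(\<Sum>i\<in>A. a i * b i) \<le> (\<Sum>i\<in>A. a i powr s) powr (1 / s) * (\<Sum>i\<in>A. b i powr t) powr (1 / t)"
proof -
  define X where "X = (\<Sum>i\<in>A. a i powr s)"
  define Y where "Y = (\<Sum>i\<in>A. b i powr t)"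
  have X0: "X \<ge> 0" and Y0: "Y \<ge> 0" by (auto simp: X_def Y_def intro: sum_nonneg)
  show ?thesis
  proof (cases "X = 0 \<or> Y = 0")
    case True
    then have "a i * b i = 0" if "i \<in> A" for i
      using that \<open>finite A\<close> by (auto simp: X_def Y_def sum_nonneg_eq_0_iff)
    then have "(\<Sum>i\<in>A. a i * b i) = 0" by (rule sum.neutral[rule_format])
    then show ?thesis by simp
  next
    case False
    then have X: "X > 0" and Y: "Y > 0" using X0 Y0 by auto
    define x where "x = X powr (1 / s)"
    define y where "y = Y powr (1 / t)"
    have xy: "x > 0" "y > 0" "x powr s = X" "y powr t = Y"
      using X Y assms by (auto simp: x_def y_def powr_powr)
    have "(\<Sum>i\<in>A. (a i / x) * (b i / y))
        \<le> (\<Sum>i\<in>A. (a i / x) powr s / s + (b i / y) powr t / t)"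
      using assms xy by (intro sum_mono Youngs_inequality) auto
    also have "\<dots> = (\<Sum>i\<in>A. a i powr s / X / s + b i powr t / Y / t)"
      using a b xy by (intro sum.cong refl) (simp add: powr_divide)
    also have "\<dots> = 1"
      using X Y assms(4)
      by (simp add: sum.distrib sum_divide_distrib[symmetric] X_def[symmetric] Y_def[symmetric])
    finally have "(\<Sum>i\<in>A. a i * b i) / (x * y) \<le> 1"
      by (simp add: sum_divide_distrib)
    then show ?thesis
      using xy by (simp add: field_simps x_def y_def X_def Y_def)
  qed
qed

text \<open>Bounding the sum by twice the maximum avoids convexity of the power, so exponents below
  1 are covered as well.\<close>

lemma powr_add_le:
  fixes x y p :: real
  assumes "0 \<le> x" "0 \<le> y" "0 < p"
  shows "(x + y) powr p \<le> 2 powr p * (x powr p + y powr p)"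
proof -
  have "(x + y) powr p \<le> (2 * max x y) powr p"
    using assms by (intro powr_mono2) auto
  also have "\<dots> = 2 powr p * max x y powr p"
    using assms by (simp add: powr_mult)
  also have "\<dots> \<le> 2 powr p * (x powr p + y powr p)"
    by (intro mult_left_mono) (auto simp: max_def)
  finally show ?thesis .
qed

section \<open>Means on a single level\<close>

lemma level_mean_nonneg [simp]: "0 \<le> level_mean G \<rho> p n f"
  by (simp add: level_mean_def)

lemma level_mean_powr:
  assumes "p \<noteq> 0"
  shows "level_mean G \<rho> p n f powr p =
    1 / real (card (level_set G \<rho> n)) * (\<Sum>v\<in>level_set G \<rho> n. cmod (f v) powr p)"
  using assms unfolding level_mean_def
  by (simp add: powr_powr sum_nonneg)

text \<open>Strict monotonicity of \<open>x powr p\<close> on the nonnegative reals removes the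
  outer root, so estimates can be made on averaged sums.\<close>

lemma level_mean_le_iff:
  assumes "0 < p" "0 \<le> B"
  shows "level_mean G \<rho> p n f \<le> B \<longleftrightarrow>
    1 / real (card (level_set G \<rho> n)) * (\<Sum>v\<in>level_set G \<rho> n. cmod (f v) powr p) \<le> B powr p"
proof -
  have "level_mean G \<rho> p n f \<le> B \<longleftrightarrow> level_mean G \<rho> p n f powr p \<le> B powr p"
    using assms powr_mono2[of p "level_mean G \<rho> p n f" B] powr_less_mono2[of p B "level_mean G \<rho> p n f"]
    by fastforce
  then show ?thesis using assms by (simp only: level_mean_powr)
qed

lemma level_mean_cong:
  assumes "\<And>v. v \<in> level_set G \<rho> n \<Longrightarrow> cmod (f v) = cmod (g v)"
  shows "level_mean G \<rho> p n f = level_mean G \<rho> p n g"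
  using assms by (simp add: level_mean_def)

lemma level_mean_zero:
  assumes "\<And>v. v \<in> level_set G \<rho> n \<Longrightarrow> f v = 0"
  shows "level_mean G \<rho> p n f = 0"
  using assms by (simp add: level_mean_def)

lemma level_mean_zero_imp:
  assumes "finite (level_set G \<rho> n)" "level_mean G \<rho> p n f = 0" "v \<in> level_set G \<rho> n"
  shows "f v = 0"
proof -
  have "card (level_set G \<rho> n) \<noteq> 0" using assms by (auto simp: card_eq_0_iff)
  then have "(\<Sum>v\<in>level_set G \<rho> n. cmod (f v) powr p) = 0"
    using assms(2) by (simp add: level_mean_def)
  then show ?thesis using assms by (simp add: sum_nonneg_eq_0_iff)
qed

text \<open>One summand is at most the whole sum. This turns a norm bound into a bound at each
  vertex, as the extraction of a pointwise convergent subsequence requires.\<close>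

lemma cmod_le_level_mean:
  assumes "finite (level_set G \<rho> n)" "0 < p" "v \<in> level_set G \<rho> n"
  shows "cmod (f v) \<le> real (card (level_set G \<rho> n)) powr (1 / p) * level_mean G \<rho> p n f"
proof -
  let ?c = "real (card (level_set G \<rho> n))"
  have c: "?c > 0" using assms by (auto simp: card_gt_0_iff)
  have "cmod (f v) = (cmod (f v) powr p) powr (1 / p)"
    using assms by (simp add: powr_powr)
  also have "\<dots> \<le> (\<Sum>v\<in>level_set G \<rho> n. cmod (f v) powr p) powr (1 / p)"
    using assms by (intro powr_mono2 member_le_sum) auto
  also have "\<dots> = (?c * level_mean G \<rho> p n f powr p) powr (1 / p)"
    using assms c by (simp add: level_mean_powr)
  also have "\<dots> = ?c powr (1 / p) * level_mean G \<rho> p n f"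
    using assms by (simp add: powr_mult powr_powr)
  finally show ?thesis .
qed

lemma tendsto_level_mean:
  assumes "0 < p" "\<And>v. v \<in> level_set G \<rho> n \<Longrightarrow> ((\<lambda>k. f k v) \<longlongrightarrow> g v) F"
  shows "((\<lambda>k. level_mean G \<rho> p n (f k)) \<longlongrightarrow> level_mean G \<rho> p n g) F"
  unfolding level_mean_def using assms
  by (intro tendsto_powr' tendsto_mult tendsto_sum tendsto_norm tendsto_const)
     (auto intro!: always_eventually divide_nonneg_nonneg sum_nonneg)

text \<open>For \<open>p < 1\<close> the means are only quasi-norms, hence the constant.\<close>

lemma level_mean_diff_le:
  assumes "0 < p" "level_mean G \<rho> p n f \<le> B" "level_mean G \<rho> p n g \<le> B"
  shows "level_mean G \<rho> p n (\<lambda>v. f v - g v) \<le> 2 powr (1 + 1 / p) * B"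
proof -
  let ?L = "level_set G \<rho> n"
  let ?S = "\<lambda>f. 1 / real (card ?L) * (\<Sum>v\<in>?L. cmod (f v) powr p)"
  have B: "0 \<le> B" by (rule order_trans[OF level_mean_nonneg assms(2)])
  have "?S (\<lambda>v. f v - g v)
      \<le> 1 / real (card ?L) * (\<Sum>v\<in>?L. 2 powr p * (cmod (f v) powr p + cmod (g v) powr p))"
  proof (intro mult_left_mono sum_mono)
    fix v
    have "cmod (f v - g v) powr p \<le> (cmod (f v) + cmod (g v)) powr p"
      using assms by (intro powr_mono2 norm_triangle_ineq4) auto
    also have "\<dots> \<le> 2 powr p * (cmod (f v) powr p + cmod (g v) powr p)"
      using assms by (intro powr_add_le) auto
    finally show "cmod (f v - g v) powr p \<le> 2 powr p * (cmod (f v) powr p + cmod (g v) powr p)" .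
  qed auto
  also have "\<dots> = 2 powr p * (?S f + ?S g)"
    by (simp only: sum_distrib_left[symmetric] sum.distrib) (simp add: algebra_simps)
  also have "\<dots> \<le> 2 powr p * (B powr p + B powr p)"
    using assms B by (intro mult_left_mono add_mono) (auto simp only: level_mean_le_iff powr_ge_zero)
  \<comment> \<open>Adding the two means costs a factor 2 under the power \<open>p\<close>, which is
    the factor \<open>2 powr (1 / p)\<close> outside it.\<close>
  also have "\<dots> = (2 powr (1 + 1 / p) * B) powr p"
    using assms B by (simp add: powr_mult powr_powr powr_add distrib_right)
  finally show ?thesis using assms B by (subst level_mean_le_iff) auto
qed

text \<open>Hoelder for the \<open>q\<close>-th powers of the moduli, with exponents
  \<open>r / q\<close> and \<open>p / q\<close>; they are conjugate because
  \<open>1 / r + 1 / p = 1 / q\<close>.\<close>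

lemma level_mean_mult_le:
  assumes "finite (level_set G \<rho> n)" "0 < q" "q < p"
  shows "level_mean G \<rho> q n (mult_op \<psi> f)
    \<le> level_mean G \<rho> (p * q / (p - q)) n \<psi> * level_mean G \<rho> p n f"
proof -
  let ?L = "level_set G \<rho> n"
  define r where "r = p * q / (p - q)"
  have r: "r > 0" "1 / r + 1 / p = 1 / q" "q < r"
    using assms by (auto simp: r_def field_simps)
  define s where "s = r / q"
  define t where "t = p / q"
  have "q / r + q / p = q * (1 / r + 1 / p)" by (simp add: distrib_left)
  then have st: "s > 1" "t > 1" "1 / s + 1 / t = 1"
    using assms r by (auto simp: s_def t_def)
  define A where "A = 1 / real (card ?L)"
  define X where "X = (\<Sum>v\<in>?L. cmod (\<psi> v) powr r)"
  define Y where "Y = (\<Sum>v\<in>?L. cmod (f v) powr p)"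
  have A: "A \<ge> 0" "X \<ge> 0" "Y \<ge> 0" by (auto simp: A_def X_def Y_def intro: sum_nonneg)
  have "(\<Sum>v\<in>?L. cmod (mult_op \<psi> f v) powr q)
      = (\<Sum>v\<in>?L. cmod (\<psi> v) powr q * cmod (f v) powr q)"
    by (simp add: mult_op_def norm_mult powr_mult)
  also have "\<dots> \<le> (\<Sum>v\<in>?L. (cmod (\<psi> v) powr q) powr s) powr (1 / s)
      * (\<Sum>v\<in>?L. (cmod (f v) powr q) powr t) powr (1 / t)"
    using assms st by (intro Holder_inequality_sum) auto
  also have "\<dots> = X powr (q / r) * Y powr (q / p)"
    using assms by (simp add: powr_powr s_def t_def X_def Y_def)
  finally have "level_mean G \<rho> q n (mult_op \<psi> f)
      \<le> (A * (X powr (q / r) * Y powr (q / p))) powr (1 / q)"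
    unfolding level_mean_def A_def using assms
    by (intro powr_mono2 mult_left_mono mult_nonneg_nonneg sum_nonneg) auto
  \<comment> \<open>The same exponent identity splits the weight \<open>A\<close>, so that each
    factor receives exactly the normalization of its own mean.\<close>
  also have "\<dots> = A powr (1 / r + 1 / p) * (X powr (1 / r) * Y powr (1 / p))"
    using assms r A by (simp add: powr_mult powr_powr)
  also have "\<dots> = (A * X) powr (1 / r) * (A * Y) powr (1 / p)"
    using A by (simp add: powr_mult powr_add mult_ac)
  also have "\<dots> = level_mean G \<rho> r n \<psi> * level_mean G \<rho> p n f"
    by (simp add: level_mean_def A_def X_def Y_def)
  finally show ?thesis by (simp add: r_def)
qed

section \<open>The norm as a supremum of level means\<close>

lemma tree_norm_le_iff:
  assumes "0 \<le> B"
  shows "tree_norm G \<rho> p f \<le> ennreal B \<longleftrightarrow> (\<forall>n. level_mean G \<rho> p n f \<le> B)"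
  using assms by (simp add: tree_norm_def SUP_le_iff)

lemma level_mean_le_tree_norm: "ennreal (level_mean G \<rho> p n f) \<le> tree_norm G \<rho> p f"
  unfolding tree_norm_def by (rule SUP_upper) simp

lemma tree_spaceI:
  assumes "\<And>n. level_mean G \<rho> p n f \<le> B"
  shows "f \<in> tree_space G \<rho> p"
proof -
  have "0 \<le> B" by (rule order_trans[OF level_mean_nonneg assms])
  then have "tree_norm G \<rho> p f \<le> ennreal B" using assms by (simp add: tree_norm_le_iff)
  then show ?thesis by (auto simp: tree_space_def intro: le_less_trans)
qed

text \<open>A convergent real sequence is bounded, so decay of the means already yields a finite
  norm. This links the two formulations of the criterion.\<close>

lemma tendsto_level_mean_imp_tree_space0:
  assumes "(\<lambda>n. level_mean G \<rho> p n f) \<longlonglongrightarrow> 0"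
  shows "f \<in> tree_space0 G \<rho> p"
proof -
  obtain K where K: "\<forall>n. norm (level_mean G \<rho> p n f) \<le> K"
    using convergent_imp_Bseq[OF convergentI[OF assms]] unfolding Bseq_def by blast
  have "f \<in> tree_space G \<rho> p" by (rule tree_spaceI[where B = K]) (use K in auto)
  then show ?thesis using assms by (simp add: tree_space0_def)
qed

lemma tendsto_tree_norm_0I:
  assumes "\<And>e. 0 < e \<Longrightarrow> \<forall>\<^sub>F k in F. \<forall>n. level_mean G \<rho> p n (f k) \<le> e"
  shows "((\<lambda>k. tree_norm G \<rho> p (f k)) \<longlongrightarrow> 0) F"
proof (rule order_tendstoI)
  fix a :: ennreal
  assume "0 < a"
  \<comment> \<open>Norms are extended reals: an element strictly below \<open>a\<close> is finite,
    hence a real \<open>e\<close>, and \<open>b < a\<close> turns the weak bound by \<open>e\<close>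
    into a strict one.\<close>
  then obtain b where b: "0 < b" "b < a" using dense by blast
  then obtain e where e: "b = ennreal e" "0 < e" by (cases b) auto
  show "\<forall>\<^sub>F k in F. tree_norm G \<rho> p (f k) < a"
    using assms[OF e(2)]
  proof eventually_elim
    case (elim k)
    then have "tree_norm G \<rho> p (f k) \<le> b" using e by (simp add: tree_norm_le_iff)
    then show ?case using b by simp
  qed
qed auto

text \<open>The level may vary with \<open>k\<close>: the necessity proof needs both a fixed level
  and the moving level carrying the extremal function.\<close>

lemma tendsto_tree_norm_imp_tendsto_level_mean:
  assumes "((\<lambda>k. tree_norm G \<rho> p (f k)) \<longlongrightarrow> 0) F"
  shows "((\<lambda>k. level_mean G \<rho> p (n k) (f k)) \<longlongrightarrow> 0) F"
proof -
  have "((\<lambda>k. ennreal (level_mean G \<rho> p (n k) (f k))) \<longlongrightarrow> 0) F"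
    by (rule tendsto_sandwich[OF _ _ tendsto_const assms])
       (auto simp: level_mean_le_tree_norm)
  then have "((\<lambda>k. ennreal (level_mean G \<rho> p (n k) (f k))) \<longlongrightarrow> ennreal 0) F" by simp
  then show ?thesis by (rule tendsto_ennrealD) auto
qed

section \<open>Sufficiency: vanishing means give compactness\<close>

text \<open>A diagonal argument over the vertices, which are countable as a union of finite levels.
  It needs one bound for all vertices, whence the rescaling by \<open>C v\<close>.\<close>

lemma tree_space_convergent_subsequence:
  fixes f :: "nat \<Rightarrow> 'a \<Rightarrow> complex"
  assumes fin: "\<And>n. finite (level_set G \<rho> n)" and "0 < p"
    and f: "\<And>k n. level_mean G \<rho> p n (f k) \<le> B"
  obtains s g where "strict_mono s" "\<And>n. level_mean G \<rho> p n g \<le> B"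
    "\<And>v. v \<in> verts G \<Longrightarrow> (\<lambda>k. f (s k) v) \<longlonglongrightarrow> g v"
proof -
  \<comment> \<open>The summand 1 keeps \<open>C v\<close> positive even for \<open>B = 0\<close>,
    so that division by it is harmless.\<close>
  define C where "C v = real (card (level_set G \<rho> (level G \<rho> v))) powr (1 / p) * B + 1" for v
  have B: "0 \<le> B" by (rule order_trans[OF level_mean_nonneg f])
  have C: "C v > 0" for v using B by (simp add: C_def add_nonneg_pos)
  have "verts G = (\<Union>n. level_set G \<rho> n)" by (auto simp: level_set_def)
  then have count: "countable (verts G)" using fin by (simp add: countable_finite)
  have "norm (f k v / of_real (C v)) \<le> 1" if "v \<in> verts G" for k v
  proof -
    have "cmod (f k v) \<le> real (card (level_set G \<rho> (level G \<rho> v))) powr (1 / p)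
        * level_mean G \<rho> p (level G \<rho> v) (f k)"
      using that assms by (intro cmod_le_level_mean) (auto simp: level_set_def)
    also have "\<dots> \<le> C v" using f by (simp add: C_def add_increasing2 mult_left_mono)
    finally show ?thesis using C[of v] by (simp add: norm_divide)
  qed
  then obtain s :: "nat \<Rightarrow> nat" where s: "strict_mono s"
    and "\<And>v. v \<in> verts G \<Longrightarrow> \<exists>l. (\<lambda>k. f (s k) v / of_real (C v)) \<longlonglongrightarrow> l"
    using function_convergent_subsequence[OF count, of "\<lambda>k v. f k v / of_real (C v)" 1] by blast
  then obtain l where l: "\<And>v. v \<in> verts G \<Longrightarrow> (\<lambda>k. f (s k) v / of_real (C v)) \<longlonglongrightarrow> l v"
    by metis
  define g where "g v = l v * of_real (C v)" for v
  have lim: "(\<lambda>k. f (s k) v) \<longlonglongrightarrow> g v" if "v \<in> verts G" for v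
    using tendsto_mult_right[OF l[OF that], of "of_real (C v)"] C[of v]
    by (simp add: g_def less_le)
  \<comment> \<open>Each level mean is continuous under pointwise convergence, so the limit inherits
    the bound.\<close>
  have "level_mean G \<rho> p n g \<le> B" for n
  proof (rule LIMSEQ_le_const2)
    show "(\<lambda>k. level_mean G \<rho> p n (f (s k))) \<longlonglongrightarrow> level_mean G \<rho> p n g"
      using lim \<open>0 < p\<close> by (intro tendsto_level_mean) (auto simp: level_set_def)
  qed (use f in blast)
  with s lim show thesis using that by blast
qed

lemma level_mean_tendsto_0_imp_compact:
  assumes fin: "\<And>n. finite (level_set G \<rho> n)" and "0 < q" "q < p"
    and lim: "(\<lambda>n. level_mean G \<rho> (p * q / (p - q)) n \<psi>) \<longlonglongrightarrow> 0"
  shows "compact_mult_op G \<rho> p q \<psi>"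
  unfolding compact_mult_op_def
proof (intro allI impI, elim conjE)
  fix f :: "nat \<Rightarrow> 'a \<Rightarrow> complex"
  assume "(SUP k. tree_norm G \<rho> p (f k)) < \<infinity>"
  then obtain B where B: "0 \<le> B" and SB: "(SUP k. tree_norm G \<rho> p (f k)) = ennreal B"
    by (cases "SUP k. tree_norm G \<rho> p (f k)") auto
  have "tree_norm G \<rho> p (f k) \<le> ennreal B" for k
    unfolding SB[symmetric] by (rule SUP_upper) simp
  then have f: "level_mean G \<rho> p n (f k) \<le> B" for k n
    using B by (simp add: tree_norm_le_iff)
  have p: "0 < p" using assms by simp
  obtain s g where s: "strict_mono s" and g: "\<And>n. level_mean G \<rho> p n g \<le> B"
    and sg: "\<And>v. v \<in> verts G \<Longrightarrow> (\<lambda>k. f (s k) v) \<longlonglongrightarrow> g v"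
    using tree_space_convergent_subsequence[of G \<rho> p f B, OF fin p f] by blast
  define r where "r = p * q / (p - q)"
  note hold = level_mean_mult_le[OF fin \<open>0 < q\<close> \<open>q < p\<close>, folded r_def]
  obtain K where K: "\<forall>n. norm (level_mean G \<rho> r n \<psi>) \<le> K"
    using convergent_imp_Bseq[OF convergentI[OF lim]] unfolding Bseq_def r_def by blast
  \<comment> \<open>The image of the pointwise limit is the candidate for the norm limit.\<close>
  have "mult_op \<psi> g \<in> tree_space G \<rho> q"
  proof (rule tree_spaceI)
    fix n
    show "level_mean G \<rho> q n (mult_op \<psi> g) \<le> K * B"
      by (rule order_trans[OF hold mult_mono]) (use K[rule_format, of n] g order_trans[OF norm_ge_zero K[rule_format, of n]] in auto)
  qed
  define D where "D = 2 powr (1 + 1 / p) * B"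
  define h where "h k = (\<lambda>v. f (s k) v - g v)" for k
  have h: "level_mean G \<rho> p n (h k) \<le> D" for k n
    unfolding h_def D_def by (rule level_mean_diff_le[OF p f g])
  have D: "D \<ge> 0" using B by (simp add: D_def)
  have diff: "(\<lambda>v. mult_op \<psi> (f (s k)) v - mult_op \<psi> g v) = mult_op \<psi> (h k)" for k
    by (simp add: mult_op_def h_def algebra_simps)
  have "(\<lambda>k. tree_norm G \<rho> q (mult_op \<psi> (h k))) \<longlonglongrightarrow> 0"
  proof (rule tendsto_tree_norm_0I)
    fix e :: real
    assume e: "0 < e"
    have "(\<lambda>n. level_mean G \<rho> r n \<psi> * D) \<longlonglongrightarrow> 0"
      using tendsto_mult_left_zero[OF lim] by (simp add: r_def)
    then have "\<forall>\<^sub>F n in sequentially. level_mean G \<rho> r n \<psi> * D < e"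
      using e by (rule order_tendstoD)
    then obtain N where N: "\<And>n. n \<ge> N \<Longrightarrow> level_mean G \<rho> r n \<psi> * D < e"
      by (auto simp: eventually_sequentially)
    \<comment> \<open>Since \<open>D\<close> bounds the means of every \<open>h k\<close>, the
      cutoff \<open>N\<close> serves all \<open>k\<close> at once.\<close>
    have tail: "level_mean G \<rho> q n (mult_op \<psi> (h k)) \<le> e" if "n \<ge> N" for n k
    proof -
      have "level_mean G \<rho> q n (mult_op \<psi> (h k)) \<le> level_mean G \<rho> r n \<psi> * D"
        by (rule order_trans[OF hold mult_left_mono[OF h]]) simp
      then show ?thesis using N[OF that] by simp
    qed
    have "\<forall>\<^sub>F k in sequentially. level_mean G \<rho> q n (mult_op \<psi> (h k)) < e" for n
    proof (rule order_tendstoD)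
      have "(\<lambda>k. level_mean G \<rho> q n (mult_op \<psi> (h k)))
          \<longlonglongrightarrow> level_mean G \<rho> q n (\<lambda>v. \<psi> v * (g v - g v))"
        unfolding mult_op_def h_def using \<open>0 < q\<close> sg
        by (intro tendsto_level_mean tendsto_intros) (auto simp: level_set_def)
      then show "(\<lambda>k. level_mean G \<rho> q n (mult_op \<psi> (h k))) \<longlonglongrightarrow> 0"
        by (simp add: level_mean_zero)
    qed (rule e)
    then have "\<forall>\<^sub>F k in sequentially. \<forall>n\<in>{..<N}. level_mean G \<rho> q n (mult_op \<psi> (h k)) < e"
      by (intro eventually_ball_finite) auto
    then show "\<forall>\<^sub>F k in sequentially. \<forall>n. level_mean G \<rho> q n (mult_op \<psi> (h k)) \<le> e"
    proof eventually_elim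
      case (elim k)
      then show ?case using tail by (metis lessThan_iff less_imp_le not_le)
    qed
  qed
  then show "\<exists>s g. strict_mono s \<and> g \<in> tree_space G \<rho> q \<and>
      (\<lambda>k. tree_norm G \<rho> q (\<lambda>v. mult_op \<psi> (f (s k)) v - g v)) \<longlonglongrightarrow> 0"
    using s \<open>mult_op \<psi> g \<in> tree_space G \<rho> q\<close> diff by (intro exI[of _ s] exI[of _ "mult_op \<psi> g"]) auto
qed

section \<open>Necessity: extremal functions on deep levels\<close>

text \<open>The function attaining equality in Hoelder's inequality for \<open>\<psi>\<close> on the level \<open>n\<close>.\<close>

definition extremal_function ::
  "('a, 'b) pre_digraph \<Rightarrow> 'a \<Rightarrow> real \<Rightarrow> real \<Rightarrow> nat \<Rightarrow> ('a \<Rightarrow> complex) \<Rightarrow> 'a \<Rightarrow> complex" where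
  "extremal_function G \<rho> r p n \<psi> v =
     (if v \<in> level_set G \<rho> n
      then of_real ((cmod (\<psi> v) / level_mean G \<rho> r n \<psi>) powr (r / p)) else 0)"

lemma cmod_extremal_function:
  "v \<in> level_set G \<rho> n \<Longrightarrow>
    cmod (extremal_function G \<rho> r p n \<psi> v) = (cmod (\<psi> v) / level_mean G \<rho> r n \<psi>) powr (r / p)"
  unfolding extremal_function_def by (simp del: of_real_divide)

text \<open>On level \<open>n\<close> the \<open>p\<close>-th powers of the moduli are those of
  \<open>\<psi>\<close> to the power \<open>r\<close>, divided by their average, so their mean is 1;
  on other levels the function is zero.\<close>

lemma level_mean_extremal_function_le:
  assumes "0 < p" "0 < r" "0 < level_mean G \<rho> r n \<psi>"
  shows "level_mean G \<rho> p m (extremal_function G \<rho> r p n \<psi>) \<le> 1"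
proof (cases "m = n")
  case True
  let ?L = "level_set G \<rho> n"
  let ?M = "level_mean G \<rho> r n \<psi>"
  have "1 / real (card ?L) * (\<Sum>v\<in>?L. cmod (extremal_function G \<rho> r p n \<psi> v) powr p)
      = 1 / real (card ?L) * (\<Sum>v\<in>?L. cmod (\<psi> v) powr r / ?M powr r)"
    using assms
    by (intro arg_cong2[where f = "(*)"] sum.cong refl)
       (simp add: cmod_extremal_function powr_powr powr_divide)
  also have "\<dots> = 1 / real (card ?L) * (\<Sum>v\<in>?L. cmod (\<psi> v) powr r) / ?M powr r"
    by (simp add: sum_divide_distrib[symmetric] mult.commute)
  also have "\<dots> = ?M powr r / ?M powr r"
    using assms by (subst level_mean_powr) auto
  also have "\<dots> = 1" using assms by simp
  finally show ?thesis using assms True by (subst level_mean_le_iff) auto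
next
  case False
  then have "level_mean G \<rho> p m (extremal_function G \<rho> r p n \<psi>) = 0"
    by (intro level_mean_zero) (auto simp: extremal_function_def level_set_def)
  then show ?thesis by simp
qed

text \<open>The choice of \<open>r\<close> makes \<open>r * q / p + q = r\<close>: the
  \<open>q\<close>-th powers of the product are again \<open>r\<close>-th powers of
  \<open>\<psi>\<close>, and the power of the mean that remains is
  \<open>r - r * q / p = q\<close>.\<close>

lemma level_mean_mult_extremal_function:
  assumes "0 < q" "q < p" "r = p * q / (p - q)" "0 < level_mean G \<rho> r n \<psi>"
  shows "level_mean G \<rho> q n (mult_op \<psi> (extremal_function G \<rho> r p n \<psi>)) = level_mean G \<rho> r n \<psi>"
proof -
  let ?L = "level_set G \<rho> n"
  let ?M = "level_mean G \<rho> r n \<psi>"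
  have r: "r > 0" "r * q / p + q = r"
    using assms by (simp, simp add: field_simps)
  have "(\<Sum>v\<in>?L. cmod (mult_op \<psi> (extremal_function G \<rho> r p n \<psi>) v) powr q)
      = (\<Sum>v\<in>?L. cmod (\<psi> v) powr (r * q / p + q) / ?M powr (r * q / p))"
    using assms
    by (intro sum.cong refl)
       (simp add: mult_op_def cmod_extremal_function norm_mult powr_mult powr_powr powr_divide powr_add)
  also have "\<dots> = (\<Sum>v\<in>?L. cmod (\<psi> v) powr r) / ?M powr (r * q / p)"
    by (simp add: r sum_divide_distrib)
  finally have "level_mean G \<rho> q n (mult_op \<psi> (extremal_function G \<rho> r p n \<psi>))
      = (1 / real (card ?L) * (\<Sum>v\<in>?L. cmod (\<psi> v) powr r) / ?M powr (r * q / p)) powr (1 / q)"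
    by (simp add: level_mean_def)
  also have "\<dots> = (?M powr r / ?M powr (r * q / p)) powr (1 / q)"
    using r by (subst level_mean_powr) auto
  also have "\<dots> = (?M powr (r - r * q / p)) powr (1 / q)"
    by (simp add: powr_diff)
  also have "r - r * q / p = q" using r by linarith
  finally show ?thesis using assms by (simp add: powr_powr)
qed

lemma compact_imp_level_mean_tendsto_0:
  assumes fin: "\<And>n. finite (level_set G \<rho> n)" and "0 < q" "q < p"
    and compact: "compact_mult_op G \<rho> p q \<psi>"
  shows "(\<lambda>n. level_mean G \<rho> (p * q / (p - q)) n \<psi>) \<longlonglongrightarrow> 0"
proof (rule ccontr)
  define r where "r = p * q / (p - q)"
  assume "\<not> ?thesis"
  then obtain e where e: "0 < e" and "\<And>N. \<exists>n\<ge>N. e \<le> level_mean G \<rho> r n \<psi>"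
    by (auto simp: LIMSEQ_iff r_def not_less)
  \<comment> \<open>Only \<open>k \<le> N k\<close> is asked of the chosen levels; it suffices to
    push the supports past any fixed level.\<close>
  then obtain N where N: "\<And>k. k \<le> N k" "\<And>k. e \<le> level_mean G \<rho> r (N k) \<psi>"
    by metis
  have pos: "0 < level_mean G \<rho> r (N k) \<psi>" for k using e N(2) less_le_trans by blast
  have p: "0 < p" and r: "0 < r" using assms by (auto simp: r_def)
  define f where "f k = extremal_function G \<rho> r p (N k) \<psi>" for k
  have f1: "level_mean G \<rho> p n (f k) \<le> 1" for n k
    unfolding f_def by (rule level_mean_extremal_function_le[OF p r pos])
  then have fk: "f k \<in> tree_space G \<rho> p" for k by (rule tree_spaceI)
  have "tree_norm G \<rho> p (f k) \<le> ennreal 1" for k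
    using f1 by (subst tree_norm_le_iff) auto
  then have "(SUP k. tree_norm G \<rho> p (f k)) \<le> ennreal 1" by (rule SUP_least)
  then have "(SUP k. tree_norm G \<rho> p (f k)) < \<infinity>" by (rule le_less_trans) simp
  then obtain s :: "nat \<Rightarrow> nat" and g where s: "strict_mono s" and
    lim: "(\<lambda>k. tree_norm G \<rho> q (\<lambda>v. mult_op \<psi> (f (s k)) v - g v)) \<longlonglongrightarrow> 0"
    using compact fk unfolding compact_mult_op_def by blast
  \<comment> \<open>On a fixed level \<open>f (s k)\<close> vanishes eventually, hence so does the limit.\<close>
  have g: "g v = 0" if v: "v \<in> level_set G \<rho> n" for n v
  proof -
    have "(\<lambda>k. level_mean G \<rho> q n (\<lambda>v. mult_op \<psi> (f (s k)) v - g v)) \<longlonglongrightarrow> 0"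
      by (rule tendsto_tree_norm_imp_tendsto_level_mean[OF lim])
    moreover have "\<forall>\<^sub>F k in sequentially.
        level_mean G \<rho> q n (\<lambda>v. mult_op \<psi> (f (s k)) v - g v) = level_mean G \<rho> q n g"
      using eventually_gt_at_top[of n]
    proof eventually_elim
      case (elim k)
      \<comment> \<open>From \<open>n < k \<le> s k \<le> N (s k)\<close>, the image vanishes on
        level \<open>n\<close>. The difference there is \<open>- g\<close>, whose sign does not
        affect the mean.\<close>
      then have "n < N (s k)" using N(1)[of "s k"] seq_suble[OF s, of k] by linarith
      then show ?case
        by (intro level_mean_cong) (auto simp: mult_op_def f_def extremal_function_def level_set_def)
    qed
    ultimately have "(\<lambda>k::nat. level_mean G \<rho> q n g) \<longlonglongrightarrow> 0"
      by (simp cong: tendsto_cong)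
    then have "level_mean G \<rho> q n g = 0" by (simp add: LIMSEQ_const_iff)
    then show ?thesis using level_mean_zero_imp[OF fin] v by blast
  qed
  \<comment> \<open>As \<open>g\<close> vanishes on every level, the difference on the moving level
    is the image alone, whose mean is at least \<open>e\<close> although it should tend to
    0.\<close>
  have "level_mean G \<rho> q (N (s k)) (\<lambda>v. mult_op \<psi> (f (s k)) v - g v) = level_mean G \<rho> r (N (s k)) \<psi>" for k
  proof -
    have "level_mean G \<rho> q (N (s k)) (\<lambda>v. mult_op \<psi> (f (s k)) v - g v)
        = level_mean G \<rho> q (N (s k)) (mult_op \<psi> (f (s k)))"
      using g by (intro level_mean_cong) auto
    also have "\<dots> = level_mean G \<rho> r (N (s k)) \<psi>"
      unfolding f_def using assms(2,3) r_def pos by (rule level_mean_mult_extremal_function)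
    finally show ?thesis .
  qed
  then have "(\<lambda>k. level_mean G \<rho> r (N (s k)) \<psi>) \<longlonglongrightarrow> 0"
    using tendsto_tree_norm_imp_tendsto_level_mean[OF lim, of "\<lambda>k. N (s k)"] by simp
  then have "e \<le> 0" by (rule LIMSEQ_le_const) (use N in blast)
  with e show False by simp
qed

theorem theorem9:
  fixes G :: "('a, 'b) pre_digraph" and \<rho> :: 'a
    and p q :: real and \<psi> :: "'a \<Rightarrow> complex"
  assumes "infinite_rooted_tree G \<rho>"
    and "0 < q" and "q < p"
    and "bounded_mult_op G \<rho> p q \<psi>"
  shows "(compact_mult_op G \<rho> p q \<psi> \<longleftrightarrow>
            (\<lambda>n. level_mean G \<rho> (p * q / (p - q)) n \<psi>) \<longlonglongrightarrow> 0) \<and>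
         (compact_mult_op G \<rho> p q \<psi> \<longleftrightarrow>
            \<psi> \<in> tree_space0 G \<rho> (p * q / (p - q)))"
proof -
  have fin: "finite (level_set G \<rho> n)" for n
    using assms(1) by (rule infinite_rooted_tree.finite_level_set)
  have "compact_mult_op G \<rho> p q \<psi> \<longleftrightarrow>
      (\<lambda>n. level_mean G \<rho> (p * q / (p - q)) n \<psi>) \<longlonglongrightarrow> 0"
    using compact_imp_level_mean_tendsto_0[OF fin assms(2,3)]
      level_mean_tendsto_0_imp_compact[OF fin assms(2,3)] by blast
  moreover have "(\<lambda>n. level_mean G \<rho> (p * q / (p - q)) n \<psi>) \<longlonglongrightarrow> 0 \<longleftrightarrow>
      \<psi> \<in> tree_space0 G \<rho> (p * q / (p - q))"
    using tendsto_level_mean_imp_tree_space0[of G \<rho> "p * q / (p - q)" \<psi>]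
    by (auto simp only: tree_space0_def mem_Collect_eq)
  ultimately show ?thesis by simp
qed

end
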